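(* Let $K$ and $K'$ be two oriented twisted knot diagrams such that $K'$ is obtained from $K$ by one crossing change at a classical crossing $c\in C(K)$. If $c\notin ZC(K)$, then $$Q^{z}_{K}(s,t)-Q^{z}_{K'}(s,t)=2\,sgn(c)\bigl(s\,t^{p^{0}(c)}-1\bigr)\bigl(s\,t^{p^{1}(c)}-1\bigr),$$ and if $c\in ZC(K)$, then $$Q^{z}_{K}(s,t)-Q^{z}_{K'}(s,t)=2\,sgn(c)\bigl(s^{z(c)}t^{p^{0}(c)}-1\bigr)\bigl(s^{z(c)}t^{p^{1}(c)}-1\bigr),$$ where $sgn(c)$, $p^0(c)$, $p^1(c)$ and $z(c)$ are computed in $K$.
   Context: Twisted knot diagrams. An oriented twisted knot diagram $K$ is a generic immersed oriented closed curve in $\mathbb{R}^2$ with finitely many transverse double points, each marked either as a classical crossing (with over/under information) or as a virtual crossing (no over/under information), together with finitely many bars (short transverse marks) on the curve away from the double points. $C(K)$ is the set of classical crossings and $sgn(c)=sign(c)\in\{+1,-1\}$ is the usual sign of $c\in C(K)$. A crossing change at $c\in C(K)$ exchanges the over and under strands at $c$ and leaves the rest of the diagram unchanged. Smoothing. For $c\in C(K)$, let $K_c$ be the two-component diagram obtained by the oriented smoothing at $c$, its components labelled $0$ and $1$ (which component gets which label does not affect the definitions of $ZC(K)$, $z$ and $Q^z$). Affine index. For $l\in\{0,1\}$, traverse the $l$-component of $K_c$ once along its orientation starting near $c$, and let $\gamma_1,\dots,\gamma_{k_l}$ be the sequence of classical crossings met (with repetition). Put $\epsilon_i=0$ if the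 traversal passes under at $\gamma_i$ and $\epsilon_i=1$ if it passes over. Then $ind^{\,l}(c,K)=\sum_{i=1}^{k_l}(-1)^{\epsilon_i}sign(\gamma_i)$. (Self-crossings of the $l$-component contribute zero, and $ind^{\,1}(c,K)=-ind^{\,0}(c,K)$.) Zero crossings. $c\in C(K)$ is a zero crossing if $ind^{\,l}(c,K)$ is even for $l=0$ or $1$ (equivalently both). $ZC(K)$ is the set of zero crossings. For $c\in ZC(K)$ the zero affine index is $zind^{\,l}(c,K)=\sum_{\gamma_i\in ZC(K)}(-1)^{\epsilon_i}sign(\gamma_i)$, the sum being over those terms of the sequence $\gamma_1,\dots,\gamma_{k_l}$ of classical crossings met along the $l$-component of $K_c$ that are zero crossings of $K$, and $z(c)\in\{0,1\}$ is the residue of $zind^{\,l}(c,K)$ mod $2$ (independent of $l$). Bar parity. For $c\in C(K)$, $p^l(c)\in\{0,1\}$ is the parity of the number of bars on the $l$-component of $K_c$. The polynomial. $$Q^{z}_{K}(s,t)=\sum_{c\in ZC(K)}sgn(c)\bigl(s^{z(c)}t^{p^{0}(c)}-1\bigr)\bigl(s^{z(c)}t^{p^{1}(c)}-1\bigr)+\sum_{c\in C(K)\setminus ZC(K)}sgn(c)\bigl(s\,t^{p^{0}(c)}-1\bigr)\bigl(s\,t^{p^{1}(c)}-1\bigr).$$ *)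

theory Defs
  imports "HOL-Analysis.Analysis" "HOL-Computational_Algebra.Polynomial"
begin

section \<open>Twisted knot diagrams\<close>

text \<open>
  The oriented closed curve is a 1-periodic map; its points are indexed by parameters in
  \<open>{0..<1}\<close>. A classical crossing is recorded by its double point together with the parameter
  at which it is traversed on the over strand, a bar by its parameter. Double points that are
  not classical are the virtual crossings.
\<close>

record twisted_diagram =
  curve :: "real \<Rightarrow> real^2"
  classical :: "(real^2) set"
  overs :: "real set"
  bars :: "real set"

definition preimages :: "twisted_diagram \<Rightarrow> real^2 \<Rightarrow> real set" where
  "preimages K p = {t \<in> {0..<1}. curve K t = p}"

definition double_points :: "twisted_diagram \<Rightarrow> (real^2) set" where
  "double_points K = {p. card (preimages K p) = 2}"

definition velocity :: "twisted_diagram \<Rightarrow> real \<Rightarrow> real^2" where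
  "velocity K t = vector_derivative (curve K) (at t)"

definition frame_det :: "real^2 \<Rightarrow> real^2 \<Rightarrow> real" where
  "frame_det u v = det (vector [u, v] :: real^2^2)"

definition generic_closed_curve :: "twisted_diagram \<Rightarrow> bool" where
  "generic_closed_curve K \<longleftrightarrow>
     (\<forall>t. curve K (t + 1) = curve K t) \<and>
     curve K C1_differentiable_on UNIV \<and>
     (\<forall>t. velocity K t \<noteq> 0) \<and>
     (\<forall>p. finite (preimages K p) \<and> card (preimages K p) \<le> 2) \<and>
     finite (double_points K) \<and>
     (\<forall>s\<in>{0..<1}. \<forall>t\<in>{0..<1}. s \<noteq> t \<longrightarrow> curve K s = curve K t \<longrightarrow>
        frame_det (velocity K s) (velocity K t) \<noteq> 0)"

text \<open>The bijection says that exactly one of the two passages through each classical crossing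
  is an over passage.\<close>

definition twisted_knot_diagram :: "twisted_diagram \<Rightarrow> bool" where
  "twisted_knot_diagram K \<longleftrightarrow>
     generic_closed_curve K \<and>
     classical K \<subseteq> double_points K \<and>
     overs K \<subseteq> {0..<1} \<and> bij_betw (curve K) (overs K) (classical K) \<and>
     finite (bars K) \<and> bars K \<subseteq> {0..<1} \<and> (\<forall>b\<in>bars K. curve K b \<notin> double_points K)"

definition over_at :: "twisted_diagram \<Rightarrow> real^2 \<Rightarrow> real" where
  "over_at K c = (THE t. t \<in> preimages K c \<and> t \<in> overs K)"

definition under_at :: "twisted_diagram \<Rightarrow> real^2 \<Rightarrow> real" where
  "under_at K c = (THE t. t \<in> preimages K c \<and> t \<notin> overs K)"

text \<open>A crossing is positive when the over strand, followed by the under strand, is a positively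
  oriented frame of the plane.\<close>

definition crossing_sign :: "twisted_diagram \<Rightarrow> real^2 \<Rightarrow> int" where
  "crossing_sign K c =
     (if frame_det (velocity K (over_at K c)) (velocity K (under_at K c)) > 0 then 1 else -1)"

definition crossing_change :: "twisted_diagram \<Rightarrow> real^2 \<Rightarrow> twisted_diagram" where
  "crossing_change K c =
     K\<lparr>overs := (overs K - preimages K c) \<union> (preimages K c - overs K)\<rparr>"

section \<open>Smoothing and indices\<close>

text \<open>
  The oriented smoothing at \<open>c\<close> cuts the curve at the two passages through \<open>c\<close>, so the two
  components of \<open>K\<^sub>c\<close> are the two cyclic parameter arcs between them; the crossing \<open>c\<close>
  itself disappears. A labelling chooses, for every classical crossing \<open>c\<close>, which of the two
  components is number 0 and which is number 1: \<open>lab c l\<close> is the passage through \<open>c\<close> from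
  which component \<open>l\<close> departs.
\<close>

definition cyclic_arc :: "real \<Rightarrow> real \<Rightarrow> real set" where
  "cyclic_arc a b = (if a < b then {a<..<b} else {a<..<1} \<union> {0..<b})"

definition labelling :: "twisted_diagram \<Rightarrow> (real^2 \<Rightarrow> nat \<Rightarrow> real) \<Rightarrow> bool" where
  "labelling K lab \<longleftrightarrow> (\<forall>c\<in>classical K. bij_betw (lab c) {0, 1} (preimages K c))"

definition smoothing_component :: "(real^2 \<Rightarrow> nat \<Rightarrow> real) \<Rightarrow> nat \<Rightarrow> real^2 \<Rightarrow> real set" where
  "smoothing_component lab l c = cyclic_arc (lab c l) (lab c (1 - l))"

definition passage_eps :: "twisted_diagram \<Rightarrow> real \<Rightarrow> nat" where
  "passage_eps K u = (if u \<in> overs K then 1 else 0)"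

text \<open>Summing over the passages \<open>u\<close> (rather than over the crossings \<open>curve K u\<close>) counts a
  crossing as often as it is met.\<close>

definition ind ::
    "twisted_diagram \<Rightarrow> (real^2 \<Rightarrow> nat \<Rightarrow> real) \<Rightarrow> nat \<Rightarrow> real^2 \<Rightarrow> int" where
  "ind K lab l c =
     (\<Sum>u \<in> {u \<in> smoothing_component lab l c. curve K u \<in> classical K}.
        (-1) ^ passage_eps K u * crossing_sign K (curve K u))"

definition zero_crossings ::
    "twisted_diagram \<Rightarrow> (real^2 \<Rightarrow> nat \<Rightarrow> real) \<Rightarrow> (real^2) set" where
  "zero_crossings K lab = {c \<in> classical K. \<exists>l\<in>{0, 1}. even (ind K lab l c)}"

definition zind ::
    "twisted_diagram \<Rightarrow> (real^2 \<Rightarrow> nat \<Rightarrow> real) \<Rightarrow> nat \<Rightarrow> real^2 \<Rightarrow> int" where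
  "zind K lab l c =
     (\<Sum>u \<in> {u \<in> smoothing_component lab l c. curve K u \<in> zero_crossings K lab}.
        (-1) ^ passage_eps K u * crossing_sign K (curve K u))"

text \<open>Since \<open>zind K lab 0 c + zind K lab 1 c = 0\<close>, component 0 may be used here.\<close>

definition zres :: "twisted_diagram \<Rightarrow> (real^2 \<Rightarrow> nat \<Rightarrow> real) \<Rightarrow> real^2 \<Rightarrow> nat" where
  "zres K lab c = nat (zind K lab 0 c mod 2)"

definition bar_parity ::
    "twisted_diagram \<Rightarrow> (real^2 \<Rightarrow> nat \<Rightarrow> real) \<Rightarrow> nat \<Rightarrow> real^2 \<Rightarrow> nat" where
  "bar_parity K lab l c = card (bars K \<inter> smoothing_component lab l c) mod 2"

section \<open>The polynomial\<close>

text \<open>\<open>\<int>[s,t]\<close> is realised as \<open>\<int>[s][t]\<close>.\<close>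

definition var_s :: "int poly poly" where "var_s = [:[:0, 1:]:]"

definition var_t :: "int poly poly" where "var_t = [:0, 1:]"

definition Qz :: "twisted_diagram \<Rightarrow> (real^2 \<Rightarrow> nat \<Rightarrow> real) \<Rightarrow> int poly poly" where
  "Qz K lab =
     (\<Sum>c \<in> zero_crossings K lab. of_int (crossing_sign K c)
        * (var_s ^ zres K lab c * var_t ^ bar_parity K lab 0 c - 1)
        * (var_s ^ zres K lab c * var_t ^ bar_parity K lab 1 c - 1))
   + (\<Sum>c \<in> classical K - zero_crossings K lab. of_int (crossing_sign K c)
        * (var_s * var_t ^ bar_parity K lab 0 c - 1)
        * (var_s * var_t ^ bar_parity K lab 1 c - 1))"

section \<open>Crossing changes preserve diagrams\<close>

lemma preimages_crossing_change [simp]: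
  "preimages (crossing_change K c) = preimages K"
  by (simp add: fun_eq_iff preimages_def crossing_change_def)

lemma crossing_change_simps [simp]:
  "curve (crossing_change K c) = curve K"
  "classical (crossing_change K c) = classical K"
  "bars (crossing_change K c) = bars K"
  "velocity (crossing_change K c) = velocity K"
  "double_points (crossing_change K c) = double_points K"
  by (auto simp: fun_eq_iff velocity_def double_points_def)
    (simp_all add: crossing_change_def)

lemma labelling_crossing_change [simp]:
  "labelling (crossing_change K c) lab = labelling K lab"
  by (simp add: labelling_def)

lemma twisted_knot_diagram_crossing_change:
  assumes K: "twisted_knot_diagram K" and c: "c \<in> classical K"
  shows "twisted_knot_diagram (crossing_change K c)"
proof -
  have bij: "bij_betw (curve K) (overs K) (classical K)" and sub: "overs K \<subseteq> {0..<1}"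
    and "card (preimages K c) = 2"
    using K c by (auto simp: twisted_knot_diagram_def double_points_def)
  then obtain x y where xy: "preimages K c = {x, y}" "x \<noteq> y"
    by (meson card_2_iff)
  obtain a where a: "a \<in> overs K" "curve K a = c"
    using bij c by (metis bij_betw_imp_surj_on imageE)
  have "a \<in> preimages K c"
    using a sub by (auto simp: preimages_def)
  then obtain b where ab: "preimages K c = {a, b}" "a \<noteq> b"
    using xy by (metis insert_commute insertE singletonD)
  have inj: "inj_on (curve K) (overs K)" and img: "curve K ` overs K = classical K"
    using bij by (auto simp: bij_betw_def)
  have cb: "curve K b = c" "b \<in> {0..<1}"
    using ab by (auto simp: preimages_def)
  have nb: "b \<notin> overs K"
    using inj_onD[OF inj, of b a] a cb ab(2) by metis
  have ov: "overs (crossing_change K c) = insert b (overs K - {a})"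
  proof -
    have "overs (crossing_change K c) = (overs K - {a, b}) \<union> ({a, b} - overs K)"
      by (simp add: crossing_change_def ab)
    then show ?thesis
      using a(1) nb by blast
  qed
  have "inj_on (curve K) (insert b (overs K - {a}))"
  proof -
    have "inj_on (curve K) (overs K - {a})"
      using inj by (rule inj_on_diff)
    moreover have "curve K b \<notin> curve K ` (overs K - {a})"
    proof
      assume "curve K b \<in> curve K ` (overs K - {a})"
      then obtain y where y: "curve K b = curve K y" "y \<in> overs K - {a}"
        by (rule imageE)
      have "curve K y = curve K a"
        by (simp only: y(1)[symmetric] a(2) cb(1))
      then have "y = a"
        using y(2) a(1) by (intro inj_onD[OF inj]) blast+
      with y(2) show False by blast
    qed
    ultimately show ?thesis
      unfolding inj_on_insert by blast
  qed
  moreover have "curve K ` insert b (overs K - {a}) = classical K"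
  proof -
    have "curve K ` insert b (overs K - {a}) = insert (curve K a) (curve K ` (overs K - {a}))"
      using a cb by simp
    also have "\<dots> = curve K ` insert a (overs K - {a})"
      by (rule image_insert [symmetric])
    also have "insert a (overs K - {a}) = overs K"
      using a by (simp add: insert_absorb)
    finally show ?thesis
      using img by (rule trans)
  qed
  ultimately have "bij_betw (curve K) (insert b (overs K - {a})) (classical K)"
    by (simp add: bij_betw_def)
  moreover have "generic_closed_curve (crossing_change K c) = generic_closed_curve K"
    by (simp add: generic_closed_curve_def)
  moreover have "insert b (overs K - {a}) \<subseteq> {0..<1}"
    using cb(2) sub by blast
  ultimately show ?thesis
    using K by (simp add: twisted_knot_diagram_def ov)
qed

end

theory Submission
  imports Defs
begin

text \<open>
  Modulo 2 the signs in the index sums are irrelevant, so \<open>ind\<close> and \<open>zind\<close> only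
  count passages. The two components of a smoothing together contain both passages of every other
  crossing, so the two counts agree modulo 2, whatever the labelling. Hence zero crossings and
  weights survive a crossing change, and only the sign of the changed crossing is reversed.
\<close>

section \<open>Counting passages along the two arcs of a smoothing\<close>

lemma cyclic_arc_disjoint: "a \<noteq> b \<Longrightarrow> cyclic_arc a b \<inter> cyclic_arc b a = {}"
  by (auto simp: cyclic_arc_def)

lemma cyclic_arc_Un:
  assumes "a \<in> {0..<1}" "b \<in> {0..<1}" "a \<noteq> b"
  shows "cyclic_arc a b \<union> cyclic_arc b a = {0..<1} - {a, b}"
  using assms by (auto simp: cyclic_arc_def)

lemma passages_eq_UN: "{u \<in> {0..<1}. curve K u \<in> S} = (\<Union>p\<in>S. preimages K p)"
  by (auto simp: preimages_def)

text \<open>The fibres of \<open>curve K\<close> over distinct points are disjoint, and each fibre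
  over a double point has two elements.\<close>

lemma card_passages:
  assumes "finite S" "S \<subseteq> double_points K"
  shows "finite {u \<in> {0..<1}. curve K u \<in> S}"
    and "card {u \<in> {0..<1}. curve K u \<in> S} = 2 * card S"
proof -
  have two: "card (preimages K p) = 2" if "p \<in> S" for p
    using that assms(2) by (auto simp: double_points_def)
  \<comment> \<open>An infinite set has \<open>card\<close> 0, so cardinality 2 already forces
    finiteness.\<close>
  have fin: "finite (preimages K p)" if "p \<in> S" for p
    using two[OF that] by (intro card_ge_0_finite) simp
  show "finite {u \<in> {0..<1}. curve K u \<in> S}"
    unfolding passages_eq_UN using assms(1) fin by blast
  have "card (\<Union>p\<in>S. preimages K p) = (\<Sum>p\<in>S. card (preimages K p))"
    using assms(1) fin by (intro card_UN_disjoint) (auto simp: preimages_def)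
  then show "card {u \<in> {0..<1}. curve K u \<in> S} = 2 * card S"
    unfolding passages_eq_UN by (simp add: two)
qed

lemma preimages_labelling:
  assumes "labelling K lab" "d \<in> classical K"
  shows "preimages K d = {lab d 0, lab d 1}" "lab d 0 \<noteq> lab d 1"
    "lab d 0 \<in> {0..<1}" "lab d 1 \<in> {0..<1}" "curve K (lab d 0) = d" "curve K (lab d 1) = d"
proof -
  have bij: "bij_betw (lab d) {0, 1} (preimages K d)"
    using assms by (simp add: labelling_def)
  show pre: "preimages K d = {lab d 0, lab d 1}"
    using bij_betw_imp_surj_on[OF bij] by simp
  show "lab d 0 \<noteq> lab d 1"
    using bij_betw_imp_inj_on[OF bij] by (auto simp: inj_on_def)
  have "{lab d 0, lab d 1} \<subseteq> preimages K d"
    using pre by simp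
  then show "lab d 0 \<in> {0..<1}" "lab d 1 \<in> {0..<1}"
    "curve K (lab d 0) = d" "curve K (lab d 1) = d"
    by (auto simp: preimages_def)
qed

text \<open>Common index set of both index sums: \<open>S = classical K\<close> gives
  \<open>ind\<close>, and \<open>S = zero_crossings K lab\<close> gives \<open>zind\<close>. With
  \<open>S\<close> fixed, it depends on \<open>K\<close> only through \<open>curve K\<close>, not
  through \<open>overs K\<close>.\<close>

definition component_passages ::
    "twisted_diagram \<Rightarrow> (real^2 \<Rightarrow> nat \<Rightarrow> real) \<Rightarrow> (real^2) set \<Rightarrow> nat \<Rightarrow> real^2 \<Rightarrow> real set" where
  "component_passages K lab S l d = {u \<in> smoothing_component lab l d. curve K u \<in> S}"

text \<open>Both arcs are open at the cut points, and these cut points are exactly the preimages of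
  \<open>d\<close>; this is why \<open>d\<close> drops out of \<open>S\<close>.\<close>

lemma component_passages_Un:
  assumes "labelling K lab" "d \<in> classical K"
  shows "component_passages K lab S 0 d \<union> component_passages K lab S 1 d =
      {u \<in> {0..<1}. curve K u \<in> S - {d}}"
proof -
  note p = preimages_labelling[OF assms]
  have "u \<in> {lab d 0, lab d 1} \<longleftrightarrow> curve K u = d" if "u \<in> {0..<1}" for u
    unfolding p(1)[symmetric] using that by (simp add: preimages_def)
  moreover have "component_passages K lab S 0 d \<union> component_passages K lab S 1 d =
      {u \<in> {0..<1} - {lab d 0, lab d 1}. curve K u \<in> S}"
    unfolding cyclic_arc_Un[OF p(3,4,2), symmetric]
    by (auto simp: component_passages_def smoothing_component_def)
  ultimately show ?thesis
    by blast
qed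

lemma finite_component_passages:
  assumes "labelling K lab" "d \<in> classical K" "finite S" "S \<subseteq> double_points K" "l \<in> {0, 1}"
  shows "finite (component_passages K lab S l d)"
proof -
  have "finite {u \<in> {0..<1}. curve K u \<in> S - {d}}"
    using assms by (intro card_passages) auto
  then have "finite (component_passages K lab S 0 d \<union> component_passages K lab S 1 d)"
    by (simp only: component_passages_Un[OF assms(1,2)])
  then show ?thesis
    using assms(5) by auto
qed

text \<open>The two counts add up to \<open>2 * card (S - {d})\<close>. The point \<open>d\<close>
  may lie outside \<open>S\<close>, as happens when \<open>S\<close> is the set of zero crossings
  and \<open>d\<close> is not one of them.\<close>

lemma even_card_component_passages:
  assumes "labelling K lab" "d \<in> classical K" "finite S" "S \<subseteq> double_points K"
  shows "even (card (component_passages K lab S 1 d)) \<longleftrightarrow>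
    even (card (component_passages K lab S 0 d))"
proof -
  note p = preimages_labelling[OF assms(1,2)]
  have "component_passages K lab S 0 d \<inter> component_passages K lab S 1 d = {}"
    using cyclic_arc_disjoint[OF p(2)]
    by (auto simp: component_passages_def smoothing_component_def)
  then have "card (component_passages K lab S 0 d) + card (component_passages K lab S 1 d) =
      card (component_passages K lab S 0 d \<union> component_passages K lab S 1 d)"
    using finite_component_passages[OF assms] by (simp add: card_Un_disjoint)
  also have "\<dots> = card {u \<in> {0..<1}. curve K u \<in> S - {d}}"
    by (simp only: component_passages_Un[OF assms(1,2)])
  also have "\<dots> = 2 * card (S - {d})"
    using assms by (intro card_passages) auto
  finally show ?thesis
    by (metis even_add dvd_triv_left)
qed

text \<open>Every summand is 1 or -1, hence odd. For infinite \<open>A\<close> both the sum and the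
  cardinality are 0 by convention.\<close>

lemma even_signed_sum:
  "even (\<Sum>u\<in>A. (-1) ^ passage_eps K u * crossing_sign K (f u)) \<longleftrightarrow> even (card A)"
proof (cases "finite A")
  case True
  have "odd ((-1) ^ passage_eps K u * crossing_sign K (f u))" for u
    by (simp add: crossing_sign_def)
  then show ?thesis
    using True by (simp add: even_sum_iff)
qed simp

lemma classical_double_points:
  assumes "twisted_knot_diagram K"
  shows "finite (classical K)" "classical K \<subseteq> double_points K"
  using assms finite_subset
  by (auto simp: twisted_knot_diagram_def generic_closed_curve_def)

text \<open>Equal parities on the two components collapse the choice of \<open>l\<close> to
  component 0, and the right-hand side no longer mentions signs or over passages.\<close>

lemma zero_crossings_eq:
  assumes "twisted_knot_diagram K" "labelling K lab"
  shows "zero_crossings K lab =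
    {d \<in> classical K. even (card (component_passages K lab (classical K) 0 d))}"
proof -
  have "even (ind K lab l d) \<longleftrightarrow> even (card (component_passages K lab (classical K) l d))" for l d
    by (simp add: ind_def even_signed_sum component_passages_def)
  then show ?thesis
    using even_card_component_passages[OF assms(2) _ classical_double_points[OF assms(1)]]
    by (auto simp: zero_crossings_def)
qed

lemma zres_eq: "zres K lab d = card (component_passages K lab (zero_crossings K lab) 0 d) mod 2"
proof -
  have "even (zind K lab 0 d) \<longleftrightarrow> even (card (component_passages K lab (zero_crossings K lab) 0 d))"
    by (simp add: zind_def even_signed_sum component_passages_def)
  then show ?thesis
    by (auto simp: zres_def even_iff_mod_2_eq_zero odd_iff_mod_2_eq_one)
qed

section \<open>Independence of the labelling\<close>

text \<open>Two labellings enumerate the same pair of passages through \<open>d\<close>, so they can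
  differ there only by a swap. This handles the independently chosen labellings of the two
  diagrams.\<close>

lemma smoothing_component_labelling_cases:
  assumes "labelling K lab" "labelling K lab'" "d \<in> classical K"
  obtains
    (same) "smoothing_component lab' 0 d = smoothing_component lab 0 d"
      "smoothing_component lab' 1 d = smoothing_component lab 1 d"
  | (swapped) "smoothing_component lab' 0 d = smoothing_component lab 1 d"
      "smoothing_component lab' 1 d = smoothing_component lab 0 d"
proof -
  have "{lab d 0, lab d 1} = {lab' d 0, lab' d 1}"
    using preimages_labelling(1)[OF assms(1,3)] preimages_labelling(1)[OF assms(2,3)] by simp
  then have "lab d 0 = lab' d 0 \<and> lab d 1 = lab' d 1 \<or> lab d 0 = lab' d 1 \<and> lab d 1 = lab' d 0"
    by (simp only: doubleton_eq_iff)
  then show thesis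
    using that by (auto simp: smoothing_component_def)
qed

lemma even_card_component_passages_labelling:
  assumes "labelling K lab" "labelling K lab'" "d \<in> classical K"
    "finite S" "S \<subseteq> double_points K"
  shows "even (card (component_passages K lab' S 0 d)) \<longleftrightarrow>
    even (card (component_passages K lab S 0 d))"
  using assms(1-3)
proof (cases rule: smoothing_component_labelling_cases)
  case same
  then show ?thesis by (simp add: component_passages_def)
next
  case swapped
  then show ?thesis
    using even_card_component_passages[OF assms(1,3-5)] by (simp add: component_passages_def)
qed

section \<open>Invariance of the weights under a crossing change\<close>

text \<open>Exponent 1 off the zero crossings merges the two sums of \<open>Qz\<close> into one sum
  over \<open>classical K\<close>, an index set shared by both diagrams.\<close>

definition crossing_weight ::
    "twisted_diagram \<Rightarrow> (real^2 \<Rightarrow> nat \<Rightarrow> real) \<Rightarrow> real^2 \<Rightarrow> int poly poly" where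
  "crossing_weight K lab d =
     (let e = if d \<in> zero_crossings K lab then zres K lab d else 1 in
        (var_s ^ e * var_t ^ bar_parity K lab 0 d - 1)
        * (var_s ^ e * var_t ^ bar_parity K lab 1 d - 1))"

lemma Qz_eq_sum_weight:
  assumes "twisted_knot_diagram K"
  shows "Qz K lab = (\<Sum>d\<in>classical K. of_int (crossing_sign K d) * crossing_weight K lab d)"
proof -
  have "zero_crossings K lab \<subseteq> classical K"
    by (auto simp: zero_crossings_def)
  then have "(\<Sum>d\<in>classical K. of_int (crossing_sign K d) * crossing_weight K lab d) =
      (\<Sum>d\<in>classical K - zero_crossings K lab. of_int (crossing_sign K d) * crossing_weight K lab d)
      + (\<Sum>d\<in>zero_crossings K lab. of_int (crossing_sign K d) * crossing_weight K lab d)"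
    using classical_double_points(1)[OF assms] by (rule sum.subset_diff)
  then show ?thesis
    by (simp add: Qz_def crossing_weight_def Let_def mult.assoc add.commute)
qed

lemma component_passages_crossing_change [simp]:
  "component_passages (crossing_change K c) lab S l d = component_passages K lab S l d"
  by (simp add: component_passages_def)

lemma zero_crossings_crossing_change:
  assumes K: "twisted_knot_diagram K" and c: "c \<in> classical K"
    and lab: "labelling K lab" and lab': "labelling K lab'"
  shows "zero_crossings (crossing_change K c) lab' = zero_crossings K lab"
  using zero_crossings_eq[OF K lab]
    zero_crossings_eq[OF twisted_knot_diagram_crossing_change[OF K c], of lab'] lab'
    even_card_component_passages_labelling[OF lab lab' _ classical_double_points[OF K]]
  by auto

text \<open>The residue \<open>zres\<close> counts passages through zero crossings, so its
  invariance builds on that of \<open>zero_crossings\<close>. The bar parities may be interchanged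
  by the labelling, but the weight is symmetric in them.\<close>

lemma crossing_weight_crossing_change:
  assumes K: "twisted_knot_diagram K" and c: "c \<in> classical K"
    and lab: "labelling K lab" and lab': "labelling K lab'" and d: "d \<in> classical K"
  shows "crossing_weight (crossing_change K c) lab' d = crossing_weight K lab d"
proof -
  have sub: "zero_crossings K lab \<subseteq> classical K"
    by (auto simp: zero_crossings_def)
  have "finite (zero_crossings K lab)" "zero_crossings K lab \<subseteq> double_points K"
    using sub classical_double_points[OF K] finite_subset by auto
  then have "zres (crossing_change K c) lab' d = zres K lab d"
    using even_card_component_passages_labelling[OF lab lab' d, of "zero_crossings K lab"]
    by (simp add: zres_eq zero_crossings_crossing_change[OF K c lab lab'] mod2_eq_if)
  moreover from lab lab' d have
    "bar_parity (crossing_change K c) lab' 0 d = bar_parity K lab 0 d \<and>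
     bar_parity (crossing_change K c) lab' 1 d = bar_parity K lab 1 d \<or>
     bar_parity (crossing_change K c) lab' 0 d = bar_parity K lab 1 d \<and>
     bar_parity (crossing_change K c) lab' 1 d = bar_parity K lab 0 d"
    by (cases rule: smoothing_component_labelling_cases) (simp_all add: bar_parity_def)
  ultimately show ?thesis
    unfolding crossing_weight_def zero_crossings_crossing_change[OF K c lab lab'] Let_def
    \<comment> \<open>In the swapped case the two factors trade places.\<close>
    by (elim disjE conjE) (simp_all only: mult.commute)
qed

section \<open>Signs under a crossing change\<close>

lemma over_under_at:
  assumes "preimages K d = {a, b}" "a \<in> overs K" "b \<notin> overs K"
  shows "over_at K d = a" "under_at K d = b"
  using assms by (auto simp: over_at_def under_at_def)

text \<open>Surjectivity of \<open>curve K\<close> from \<open>overs K\<close> onto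
  \<open>classical K\<close> supplies the over passage \<open>a\<close>; injectivity keeps the other
  passage \<open>b\<close> out of \<open>overs K\<close>.\<close>

lemma classical_passages:
  assumes K: "twisted_knot_diagram K" and d: "d \<in> classical K"
  obtains a b where "preimages K d = {a, b}" "a \<in> overs K" "b \<notin> overs K"
proof -
  have bij: "bij_betw (curve K) (overs K) (classical K)" and sub: "overs K \<subseteq> {0..<1}"
    and "card (preimages K d) = 2"
    using K d by (auto simp: twisted_knot_diagram_def double_points_def)
  then obtain x y where xy: "preimages K d = {x, y}" "x \<noteq> y"
    by (meson card_2_iff)
  obtain a where a: "a \<in> overs K" "curve K a = d"
    using bij d by (metis bij_betw_imp_surj_on imageE)
  have "a \<in> preimages K d"
    using a sub by (auto simp: preimages_def)
  then obtain b where ab: "preimages K d = {a, b}" "a \<noteq> b"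
    using xy by (metis insert_commute insertE singletonD)
  have "b \<notin> overs K"
  proof
    assume "b \<in> overs K"
    moreover have "curve K b = d"
      using ab(1) by (auto simp: preimages_def)
    ultimately show False
      using inj_onD[OF bij_betw_imp_inj_on[OF bij], of a b] a ab(2) by simp
  qed
  then show thesis
    using that ab(1) a(1) by blast
qed

lemma frame_det_commute: "frame_det v u = - frame_det u v"
  by (simp add: frame_det_def det_2 vector_2)

lemma crossing_sign_crossing_change:
  assumes K: "twisted_knot_diagram K" and c: "c \<in> classical K"
  shows "crossing_sign (crossing_change K c) c = - crossing_sign K c"
proof -
  obtain a b where ab: "preimages K c = {a, b}" "a \<in> overs K" "b \<notin> overs K"
    using classical_passages[OF K c] .
  have "preimages (crossing_change K c) c = {b, a}"
    using ab(1) by auto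
  moreover have "b \<in> overs (crossing_change K c)" "a \<notin> overs (crossing_change K c)"
    using ab by (auto simp: crossing_change_def)
  ultimately have "over_at (crossing_change K c) c = b" "under_at (crossing_change K c) c = a"
    by (rule over_under_at)+
  moreover have "a \<in> preimages K c" "b \<in> preimages K c"
    using ab(1) by auto
  \<comment> \<open>Transversality matters here: \<open>crossing_sign\<close> is -1 whenever the
    determinant is not positive, so a zero determinant would give -1 before and after the
    change.\<close>
  then have "frame_det (velocity K a) (velocity K b) \<noteq> 0"
    using K ab(2,3) unfolding twisted_knot_diagram_def generic_closed_curve_def preimages_def
    by (smt (verit, best) mem_Collect_eq)
  ultimately show ?thesis
    using over_under_at[OF ab] frame_det_commute[of "velocity K b" "velocity K a"]
    by (simp add: crossing_sign_def)
qed

text \<open>The change alters \<open>overs K\<close> only on the preimages of \<open>c\<close>,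
  which are disjoint from those of \<open>d\<close>.\<close>

lemma crossing_sign_crossing_change_other:
  assumes "d \<noteq> c"
  shows "crossing_sign (crossing_change K c) d = crossing_sign K d"
proof -
  have "t \<in> overs (crossing_change K c) \<longleftrightarrow> t \<in> overs K" if "t \<in> preimages K d" for t
    using that assms by (auto simp: crossing_change_def preimages_def)
  then have "over_at (crossing_change K c) d = over_at K d"
    "under_at (crossing_change K c) d = under_at K d"
    by (auto simp: over_at_def under_at_def cong: conj_cong)
  then show ?thesis
    by (simp add: crossing_sign_def)
qed

theorem lemma6p1:
  fixes K K' :: twisted_diagram
    and lab lab' :: "real^2 \<Rightarrow> nat \<Rightarrow> real"
    and c :: "real^2"
  assumes "twisted_knot_diagram K" and "twisted_knot_diagram K'"
    and "labelling K lab" and "labelling K' lab'"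
    and "c \<in> classical K"
    and "K' = crossing_change K c"
  shows "(c \<notin> zero_crossings K lab \<longrightarrow>
            Qz K lab - Qz K' lab' =
              2 * of_int (crossing_sign K c)
                * (var_s * var_t ^ bar_parity K lab 0 c - 1)
                * (var_s * var_t ^ bar_parity K lab 1 c - 1)) \<and>
         (c \<in> zero_crossings K lab \<longrightarrow>
            Qz K lab - Qz K' lab' =
              2 * of_int (crossing_sign K c)
                * (var_s ^ zres K lab c * var_t ^ bar_parity K lab 0 c - 1)
                * (var_s ^ zres K lab c * var_t ^ bar_parity K lab 1 c - 1))"
proof -
  note K = assms(1) and lab = assms(3) and c = assms(5)
  have K': "twisted_knot_diagram (crossing_change K c)" and lab': "labelling K lab'"
    using assms by auto
  let ?term = "\<lambda>d. of_int (crossing_sign K d) * crossing_weight K lab d"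
  let ?term' = "\<lambda>d. of_int (crossing_sign (crossing_change K c) d) * crossing_weight K lab d"
  \<comment> \<open>The weights of \<open>K'\<close> under \<open>lab'\<close> are replaced by those
    of \<open>K\<close> under \<open>lab\<close>, so the two sums differ in signs only.\<close>
  have "Qz K lab - Qz K' lab' = sum ?term (classical K) - sum ?term' (classical K)"
    by (simp add: assms(6) Qz_eq_sum_weight[OF K] Qz_eq_sum_weight[OF K']
        crossing_weight_crossing_change[OF K c lab lab'])
  also have "\<dots> = (?term c + sum ?term (classical K - {c}))
      - (?term' c + sum ?term' (classical K - {c}))"
    by (simp only: sum.remove[OF classical_double_points(1)[OF K] c])
  also have "sum ?term' (classical K - {c}) = sum ?term (classical K - {c})"
    by (intro sum.cong) (simp_all add: crossing_sign_crossing_change_other)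
  \<comment> \<open>The sums away from \<open>c\<close> cancel; the sign reversal at
    \<open>c\<close> turns the difference into a sum of two equal terms, whence the factor
    2.\<close>
  finally have "Qz K lab - Qz K' lab' = 2 * of_int (crossing_sign K c) * crossing_weight K lab c"
    by (simp add: crossing_sign_crossing_change[OF K c] algebra_simps)
  then show ?thesis
    by (simp add: crossing_weight_def Let_def mult.assoc)
qed

end
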